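(* Let $X,Y$ be metric spaces with $X$ complete, $F:X\times\mathbb{R}_+\rightrightarrows Y$ a set-valued mapping, $t>0$ and $(x,t,y)\in\operatorname{gph}F$. Suppose that the mapping $\tau\mapsto F_\tau^{-1}(y)$ on $\mathbb{R}_+$ is outer semicontinuous at $0$ and there are functions $b,m,\mu:(0,\infty)\to(0,\infty)$ such that $$m(\tau)\downarrow0\quad\Rightarrow\quad\tau\downarrow0$$ and, for each $\tau>0$ with $\mu(\tau)\le\mu(t)$, $$\mu(\tau)\ge m(\tau)+\mu(b(\tau)),$$ $$d\left(u,F_{b(\tau)}^{-1}(y)\right)<m(\tau)\quad\text{for all } u\in F_\tau^{-1}(y)\cap B(x,\mu(t)-\mu(\tau)).$$ Then $d(x,F_0^{-1}(y))<\mu(t)$.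
   Context: $\mathbb{R}_+=[0,\infty)$. $B(x,r)$ is the open ball of radius $r>0$ centered at $x$, and $B(x,0)=\{x\}$. $d(x,C)=\inf_{c\in C}d(x,c)$, with $d(x,\emptyset)=+\infty$. A set-valued mapping has possibly empty values; $\operatorname{gph}F=\{(x,t,y)\mid y\in F(x,t)\}$, $F_t:=F(\cdot,t):X\rightrightarrows Y$, and $F_t^{-1}(y)=\{x\in X\mid y\in F(x,t)\}$. A mapping $\Phi:\mathbb{R}_+\rightrightarrows X$ is outer semicontinuous at $\bar\tau$ if $\{z\in X\mid \liminf_{\tau\to\bar\tau,\,\tau\in\mathbb{R}_+}d(z,\Phi(\tau))=0\}\subset\Phi(\bar\tau)$. The condition "$m(\tau)\downarrow0\Rightarrow\tau\downarrow0$" means: for any sequence of positive numbers $(\tau_n)$, if $m(\tau_n)\to0$ then $\tau_n\to0$. *)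

theory Defs
  imports "HOL-Analysis.Analysis"
begin

text \<open>Point-to-set distance with \<open>d(x, {}) = \<infinity>\<close>. The library's \<^const>\<open>infdist\<close> is not
  usable here, since it assigns distance \<open>0\<close> to the empty set.\<close>

definition edist_set :: "'a::metric_space \<Rightarrow> 'a set \<Rightarrow> ereal" where
  "edist_set x C = (INF c\<in>C. ereal (dist x c))"

text \<open>Open ball with the convention \<open>B(x, 0) = {x}\<close>; the library's \<open>ball x 0\<close> is empty.\<close>

definition ball0 :: "'a::metric_space \<Rightarrow> real \<Rightarrow> 'a set" where
  "ball0 x r = (if r = 0 then {x} else ball x r)"

text \<open>A set-valued mapping on \<open>X \<times> [0, \<infinity>)\<close> is a function on \<open>X \<times> \<real>\<close> whose values at
  negative times are never consulted.\<close>

definition gph :: "('a \<times> real \<Rightarrow> 'b set) \<Rightarrow> ('a \<times> real \<times> 'b) set" where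
  "gph F = {(x, t, y). 0 \<le> t \<and> y \<in> F (x, t)}"

definition slice_inv :: "('a \<times> real \<Rightarrow> 'b set) \<Rightarrow> real \<Rightarrow> 'b \<Rightarrow> 'a set" where
  "slice_inv F t y = {x. y \<in> F (x, t)}"

text \<open>The lower limit is over \<open>\<tau> \<rightarrow> \<tau>\<^sub>0\<close> in \<open>[0, \<infinity>)\<close> with \<open>\<tau> \<noteq> \<tau>\<^sub>0\<close>, as usual for
  \<^term>\<open>at \<tau>\<^sub>0 within {0..}\<close>. Letting \<open>\<tau>\<close> also take the value \<open>\<tau>\<^sub>0\<close> gives a more
  restrictive property, which additionally forces \<open>\<Phi> \<tau>\<^sub>0\<close> to be closed.\<close>

definition outer_semicontinuous_at :: "(real \<Rightarrow> 'a::metric_space set) \<Rightarrow> real \<Rightarrow> bool" where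
  "outer_semicontinuous_at \<Phi> \<tau>\<^sub>0 \<longleftrightarrow>
     {z. Liminf (at \<tau>\<^sub>0 within {0..}) (\<lambda>\<tau>. edist_set z (\<Phi> \<tau>)) = 0} \<subseteq> \<Phi> \<tau>\<^sub>0"

end

theory Submission imports Defs begin

text \<open>The function \<open>\<mu>\<close> serves as a Lyapunov function for an Ekeland-type iteration. Starting
  from \<open>x\<close> at time \<open>t\<close>, run through the times \<open>\<tau>\<^sub>n = b\<^sup>n(t)\<close> and choose points
  \<open>u\<^sub>n \<in> F\<^sub>\<tau>\<^sup>-\<^sup>1(y)\<close>, \<open>\<tau> = \<tau>\<^sub>n\<close>, such that the step from \<open>u\<^sub>n\<close> to
  \<open>u\<^sub>n\<^sub>+\<^sub>1\<close> is shorter than \<open>m(\<tau>\<^sub>n)\<close>. Since each step is paid for by the decrease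
  \<open>\<mu>(\<tau>\<^sub>n) - \<mu>(\<tau>\<^sub>n\<^sub>+\<^sub>1) \<ge> m(\<tau>\<^sub>n)\<close>, the points stay in the balls on which the
  hypothesis is available, and the choice can be repeated forever.

  The distance between two iterates is at most the difference of the corresponding values of
  \<open>\<mu>\<close>. These values decrease and are positive, so they converge; hence the iterates form a
  Cauchy sequence with a limit \<open>z\<close> (\<open>dominated_steps_limit\<close>), and
  \<open>m(\<tau>\<^sub>n) \<rightarrow> 0\<close>, which forces \<open>\<tau>\<^sub>n \<rightarrow> 0\<close>. Outer semicontinuity then puts \<open>z\<close> into
  \<open>F\<^sub>0\<^sup>-\<^sup>1(y)\<close> (\<open>outer_semicontinuous_limit\<close>). The resulting bound
  \<open>d(x, z) \<le> \<mu>(t)\<close> is strict because the first step is strictly shorter than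
  \<open>m(t)\<close>.\<close>

lemma edist_set_le: "c \<in> C \<Longrightarrow> edist_set x C \<le> ereal (dist x c)"
  unfolding edist_set_def by (rule INF_lower)

lemma edist_set_nonneg: "0 \<le> edist_set x C"
  unfolding edist_set_def by (rule INF_greatest) simp

lemma edist_set_lessE:
  assumes "edist_set x C < ereal r"
  obtains c where "c \<in> C" "dist x c < r"
  using assms unfolding edist_set_def by (auto simp: INF_less_iff)

text \<open>A lower limit is bounded by the values along any single sequence, so one sequence of
  points of the \<open>\<Phi> (s n)\<close> is enough to exhibit its limit as an element of the left-hand side
  in the definition of outer semicontinuity.\<close>

lemma outer_semicontinuous_limit:
  assumes osc: "outer_semicontinuous_at \<Phi> 0"
    and pos: "\<And>n. s n > 0" and s: "s \<longlonglongrightarrow> 0"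
    and mem: "\<And>n. u n \<in> \<Phi> (s n)" and u: "u \<longlonglongrightarrow> z"
  shows "z \<in> \<Phi> 0"
proof -
  let ?e = "\<lambda>\<tau>. edist_set z (\<Phi> \<tau>)"
  let ?A = "at 0 within {0::real..}"
  have s': "filterlim s ?A sequentially"
    unfolding filterlim_at using s pos
    by (auto intro!: always_eventually simp: less_imp_le) (metis less_irrefl)
  have "Liminf ?A ?e \<le> 0"
  proof (rule ccontr)
    assume "\<not> Liminf ?A ?e \<le> 0"
    then obtain c where c: "0 < ereal c" "ereal c < Liminf ?A ?e"
      using ereal_dense2[of 0 "Liminf ?A ?e"] by (auto simp: not_le)
    have "eventually (\<lambda>n. ereal c < ?e (s n)) sequentially"
      using less_LiminfD[OF c(2)] s' by (rule eventually_compose_filterlim)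
    moreover have "eventually (\<lambda>n. dist (u n) z < c) sequentially"
      using tendstoD[OF u, of c] c(1) by simp
    ultimately have "eventually (\<lambda>n. False) sequentially"
    proof eventually_elim
      case (elim n)
      have "ereal c < ereal (dist z (u n))"
        using elim(1) edist_set_le[OF mem[of n]] by (rule less_le_trans)
      with elim(2) show ?case by (simp add: dist_commute)
    qed
    then show False by simp
  qed
  moreover have "0 \<le> Liminf ?A ?e"
    by (rule Liminf_bounded) (simp add: edist_set_nonneg)
  ultimately show ?thesis
    using osc unfolding outer_semicontinuous_at_def by auto
qed

lemma dist_le_telescope:
  fixes u :: "nat \<Rightarrow> 'a::metric_space" and a :: "nat \<Rightarrow> real"
  assumes "\<And>n. dist (u n) (u (Suc n)) \<le> a n - a (Suc n)" and "i \<le> j"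
  shows "dist (u i) (u j) \<le> a i - a j"
  using \<open>i \<le> j\<close>
proof (induction j rule: dec_induct)
  case (step n)
  then show ?case
    using assms(1)[of n] dist_triangle[of "u i" "u (Suc n)" "u n"] by linarith
qed simp

text \<open>Telescoping bounds the distance of two iterates by the difference of the values of \<open>a\<close>,
  so the iterates inherit the Cauchy property from the decreasing, bounded below sequence
  \<open>a\<close>.\<close>

lemma dominated_steps_limit:
  fixes u :: "nat \<Rightarrow> 'a::complete_space" and a :: "nat \<Rightarrow> real"
  assumes step: "\<And>n. dist (u n) (u (Suc n)) \<le> a n - a (Suc n)"
    and nonneg: "\<And>n. 0 \<le> a n"
  obtains z where "u \<longlonglongrightarrow> z" and "\<And>n. dist (u n) z \<le> a n"
    and "(\<lambda>n. a n - a (Suc n)) \<longlonglongrightarrow> 0"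
proof -
  have "a (Suc n) \<le> a n" for n
    using step[of n] zero_le_dist[of "u n" "u (Suc n)"] by linarith
  then have "decseq a" by (rule decseq_SucI)
  then obtain l where l: "a \<longlonglongrightarrow> l"
    using decseq_convergent[of a 0] nonneg by blast
  then have "Cauchy a" by (rule LIMSEQ_imp_Cauchy)
  have "Cauchy u"
  proof (rule metric_CauchyI)
    fix e :: real assume "0 < e"
    then obtain N where N: "\<And>i j. i \<ge> N \<Longrightarrow> j \<ge> N \<Longrightarrow> dist (a i) (a j) < e"
      using metric_CauchyD[OF \<open>Cauchy a\<close>] by blast
    have *: "dist (u i) (u j) < e" if "N \<le> i" "i \<le> j" for i j
      using dist_le_telescope[of u a, OF step \<open>i \<le> j\<close>] N[of i j] that
      by (simp add: dist_real_def)
    have "dist (u i) (u j) < e" if "N \<le> i" "N \<le> j" for i j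
      using *[of i j] *[of j i] that by (cases "i \<le> j") (auto simp: dist_commute)
    then show "\<exists>M. \<forall>i\<ge>M. \<forall>j\<ge>M. dist (u i) (u j) < e" by blast
  qed
  then obtain z where z: "u \<longlonglongrightarrow> z"
    using Cauchy_convergent convergent_def by blast
  have "dist (u n) z \<le> a n" for n
  proof (rule tendsto_upperbound)
    show "(\<lambda>j. dist (u n) (u j)) \<longlonglongrightarrow> dist (u n) z"
      using z by (intro tendsto_intros)
    show "eventually (\<lambda>j. dist (u n) (u j) \<le> a n) sequentially"
      using eventually_ge_at_top[of n]
    proof eventually_elim
      case (elim j)
      then show ?case
        using dist_le_telescope[of u a, OF step elim] nonneg[of j] by linarith
    qed
  qed simp
  moreover have "(\<lambda>n. a n - a (Suc n)) \<longlonglongrightarrow> 0"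
    using tendsto_diff[OF l LIMSEQ_Suc[OF l]] by simp
  ultimately show thesis using z that by blast
qed

theorem theorem2p4:
  fixes F :: "'a::complete_space \<times> real \<Rightarrow> 'b::metric_space set"
    and x :: 'a and y :: 'b and t :: real
    and b m \<mu> :: "real \<Rightarrow> real"
  assumes "t > 0"
    and "(x, t, y) \<in> gph F"
    and "outer_semicontinuous_at (\<lambda>\<tau>. slice_inv F \<tau> y) 0"
    and "b \<in> {0<..} \<rightarrow> {0<..}"
    and "m \<in> {0<..} \<rightarrow> {0<..}"
    and "\<mu> \<in> {0<..} \<rightarrow> {0<..}"
    and "\<And>s :: nat \<Rightarrow> real. (\<And>n. s n > 0) \<Longrightarrow> (\<lambda>n. m (s n)) \<longlonglongrightarrow> 0 \<Longrightarrow> s \<longlonglongrightarrow> 0"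
    and "\<And>\<tau>. \<tau> > 0 \<Longrightarrow> \<mu> \<tau> \<le> \<mu> t \<Longrightarrow> \<mu> \<tau> \<ge> m \<tau> + \<mu> (b \<tau>)"
    and "\<And>\<tau> u. \<tau> > 0 \<Longrightarrow> \<mu> \<tau> \<le> \<mu> t \<Longrightarrow> u \<in> slice_inv F \<tau> y \<inter> ball0 x (\<mu> t - \<mu> \<tau>) \<Longrightarrow>
           edist_set u (slice_inv F (b \<tau>) y) < ereal (m \<tau>)"
  shows "edist_set x (slice_inv F 0 y) < ereal (\<mu> t)"
proof -
  note t = assms(1) and gph = assms(2) and osc = assms(3)
    and m_lim = assms(7) and decr = assms(8) and near = assms(9)
  have b_pos: "b \<tau> > 0" and m_pos: "m \<tau> > 0" and \<mu>_pos: "\<mu> \<tau> > 0" if "\<tau> > 0" for \<tau>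
    using assms(4-6) that by auto
  define T where "T n = (b ^^ n) t" for n
  define a where "a n = \<mu> (T n)" for n
  have T_0: "T 0 = t" and T_Suc: "T (Suc n) = b (T n)" for n
    by (simp_all add: T_def)
  have T_pos: "T n > 0" for n
    by (induction n) (simp_all add: T_0 T_Suc t b_pos)
  have a_pos: "a n > 0" for n
    by (simp add: a_def T_pos \<mu>_pos)
  have a_le: "a n \<le> \<mu> t" for n
  proof (induction n)
    case (Suc n)
    then show ?case
      using decr[OF T_pos[of n]] m_pos[OF T_pos[of n]] by (simp add: a_def T_Suc)
  qed (simp add: a_def T_0)
  have a_decr: "m (T n) + a (Suc n) \<le> a n" for n
    using decr[OF T_pos[of n]] a_le[of n] by (simp add: a_def T_Suc)

  have "\<exists>u. \<forall>n. (u n \<in> slice_inv F (T n) y \<inter> ball0 x (\<mu> t - a n) \<and> (n = 0 \<longrightarrow> u n = x))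
      \<and> dist (u n) (u (Suc n)) < m (T n)"
  proof (rule dependent_nat_choice)
    show "\<exists>v. v \<in> slice_inv F (T 0) y \<inter> ball0 x (\<mu> t - a 0) \<and> (0 = (0::nat) \<longrightarrow> v = x)"
      using gph by (auto simp: gph_def slice_inv_def ball0_def a_def T_0)
  next
    fix v n
    assume "v \<in> slice_inv F (T n) y \<inter> ball0 x (\<mu> t - a n) \<and> (n = 0 \<longrightarrow> v = x)"
    then have v: "v \<in> slice_inv F (T n) y \<inter> ball0 x (\<mu> t - a n)" by blast
    have "edist_set v (slice_inv F (T (Suc n)) y) < ereal (m (T n))"
      using near[OF T_pos[of n]] a_le[of n] v by (simp add: a_def T_Suc)
    then obtain w where w: "w \<in> slice_inv F (T (Suc n)) y" "dist v w < m (T n)"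
      by (rule edist_set_lessE)
    have "dist x v \<le> \<mu> t - a n"
      using v by (auto simp: ball0_def split: if_splits)
    then have "dist x w < \<mu> t - a (Suc n)"
      using w(2) a_decr[of n] dist_triangle[of x w v] by linarith
    \<comment> \<open>This radius is positive, so the degenerate ball occurs at the starting point only.\<close>
    then have "w \<in> ball0 x (\<mu> t - a (Suc n))"
      using zero_le_dist[of x w] by (auto simp: ball0_def)
    with w show "\<exists>w. (w \<in> slice_inv F (T (Suc n)) y \<inter> ball0 x (\<mu> t - a (Suc n))
        \<and> (Suc n = 0 \<longrightarrow> w = x)) \<and> dist v w < m (T n)" by blast
  qed
  then obtain u where u_mem: "\<And>n. u n \<in> slice_inv F (T n) y" and u_0: "u 0 = x"
    and u_step: "\<And>n. dist (u n) (u (Suc n)) < m (T n)"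
    by blast

  have "dist (u n) (u (Suc n)) \<le> a n - a (Suc n)" for n
    using u_step[of n] a_decr[of n] by linarith
  then obtain z where z: "u \<longlonglongrightarrow> z" and u_z: "\<And>n. dist (u n) z \<le> a n"
    and a_diff: "(\<lambda>n. a n - a (Suc n)) \<longlonglongrightarrow> 0"
    using dominated_steps_limit[of u a] a_pos less_imp_le by metis
  have "(\<lambda>n. m (T n)) \<longlonglongrightarrow> 0"
  proof (rule tendsto_sandwich[OF _ _ tendsto_const a_diff])
    show "eventually (\<lambda>n. 0 \<le> m (T n)) sequentially"
      using m_pos[OF T_pos] by (simp add: less_imp_le)
    show "eventually (\<lambda>n. m (T n) \<le> a n - a (Suc n)) sequentially"
      using a_decr by (simp add: le_diff_eq)
  qed
  then have "T \<longlonglongrightarrow> 0"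
    using m_lim[of T] T_pos by blast
  then have z_mem: "z \<in> slice_inv F 0 y"
    using outer_semicontinuous_limit[OF osc, of T u z] T_pos u_mem z by blast

  \<comment> \<open>Passing to the limit preserves only \<open>\<le>\<close>, so strictness is taken from the first step and
    the limit bound is applied from the second point on.\<close>
  have "dist x z \<le> dist (u 0) (u 1) + dist (u 1) z"
    using u_0 dist_triangle[of x z "u 1"] by simp
  also have "\<dots> < m (T 0) + a 1"
    using u_step[of 0] u_z[of 1] by simp
  also have "\<dots> \<le> \<mu> t"
    using a_decr[of 0] a_le[of 0] by simp
  finally show ?thesis
    using edist_set_le[OF z_mem, of x] by (simp add: le_less_trans)
qed

end
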